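(* Let $R$ be a commutative ring with identity ($1\ne 0$), let $A=\{f\in R[X] : f(0)=1\}$, and let $R[X]_A$ be the Anderson ring of $R$. Then the following are equivalent. (1) $R$ is both a von Neumann regular ring and a principal ideal ring. (2) $R[X]$ is a one-dimensional principal ideal ring. (3) $R[X]_A$ is a one-dimensional principal ideal ring.
   Context: $R[X]$ is the polynomial ring in one variable; the Anderson ring $R[X]_A$ is the localization of $R[X]$ at the multiplicative set $A$ of polynomials with constant term $1$. $R$ is a von Neumann regular ring if for every $a\in R$ there exists $b\in R$ with $a^2b=a$. A principal ideal ring is a commutative ring (possibly with zero divisors) in which every ideal is principal. Dimension means Krull dimension. *)

theory Defs
  imports "HOL-Algebra.UnivPoly" "HOL-Library.Extended_Nat"
begin

definition von_neumann_regular_ring :: "('a, 'm) ring_scheme \<Rightarrow> bool" where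
  "von_neumann_regular_ring R \<longleftrightarrow>
     cring R \<and> (\<forall>a \<in> carrier R. \<exists>b \<in> carrier R. (a [^]\<^bsub>R\<^esub> (2::nat)) \<otimes>\<^bsub>R\<^esub> b = a)"

(* Zero divisors are allowed, in contrast to the library's principal_domain. *)
definition principal_ideal_ring :: "('a, 'm) ring_scheme \<Rightarrow> bool" where
  "principal_ideal_ring R \<longleftrightarrow> cring R \<and> (\<forall>I. ideal I R \<longrightarrow> principalideal I R)"

(* The supremum of the lengths n of strict chains p 0 < ... < p n of prime ideals. The zero ring,
   which has no prime ideals, gets dimension 0 here instead of a negative value. *)
definition krull_dim :: "('a, 'm) ring_scheme \<Rightarrow> enat" where
  "krull_dim R = Sup {enat n | n. \<exists>p :: nat \<Rightarrow> 'a set.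
     (\<forall>i\<le>n. primeideal (p i) R) \<and> (\<forall>i<n. p i \<subset> p (Suc i))}"

(* The fractions a/s and b/t, represented by pairs, are equal iff u(at) = u(bs) for some u in S. *)
definition frac_rel ::
    "('a, 'm) ring_scheme \<Rightarrow> 'a set \<Rightarrow> (('a \<times> 'a) \<times> ('a \<times> 'a)) set" where
  "frac_rel R S = {((a, s), (b, t)). a \<in> carrier R \<and> s \<in> S \<and> b \<in> carrier R \<and> t \<in> S \<and>
     (\<exists>u \<in> S. u \<otimes>\<^bsub>R\<^esub> (a \<otimes>\<^bsub>R\<^esub> t) = u \<otimes>\<^bsub>R\<^esub> (b \<otimes>\<^bsub>R\<^esub> s))}"

definition fraction :: "('a, 'm) ring_scheme \<Rightarrow> 'a set \<Rightarrow> 'a \<Rightarrow> 'a \<Rightarrow> ('a \<times> 'a) set" where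
  "fraction R S a s = frac_rel R S `` {(a, s)}"

(* The unions over all representatives of x and y are unions of identical classes: see
   localization_mult and localization_add below. *)
definition localization :: "('a, 'm) ring_scheme \<Rightarrow> 'a set \<Rightarrow> ('a \<times> 'a) set ring" where
  "localization R S = \<lparr>
     carrier = (carrier R \<times> S) // frac_rel R S,
     mult = (\<lambda>x y. \<Union>(a, s) \<in> x. \<Union>(b, t) \<in> y. fraction R S (a \<otimes>\<^bsub>R\<^esub> b) (s \<otimes>\<^bsub>R\<^esub> t)),
     one = fraction R S \<one>\<^bsub>R\<^esub> \<one>\<^bsub>R\<^esub>,
     zero = fraction R S \<zero>\<^bsub>R\<^esub> \<one>\<^bsub>R\<^esub>,
     add = (\<lambda>x y. \<Union>(a, s) \<in> x. \<Union>(b, t) \<in> y.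
       fraction R S ((a \<otimes>\<^bsub>R\<^esub> t) \<oplus>\<^bsub>R\<^esub> (b \<otimes>\<^bsub>R\<^esub> s)) (s \<otimes>\<^bsub>R\<^esub> t))\<rparr>"

definition constant_term_one :: "('a, 'm) ring_scheme \<Rightarrow> (nat \<Rightarrow> 'a) set" where
  "constant_term_one R = {f \<in> carrier (UP R). coeff (UP R) f 0 = \<one>\<^bsub>R\<^esub>}"

definition anderson_ring ::
    "('a, 'm) ring_scheme \<Rightarrow> ((nat \<Rightarrow> 'a) \<times> (nat \<Rightarrow> 'a)) set ring" where
  "anderson_ring R = localization (UP R) (constant_term_one R)"

context cring
begin

context
  fixes S
  assumes S: "submonoid S R"
begin

lemma S_mem: "s \<in> S \<Longrightarrow> s \<in> carrier R" "\<one> \<in> S" "s \<in> S \<Longrightarrow> t \<in> S \<Longrightarrow> s \<otimes> t \<in> S"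
  using S by (auto simp: submonoid_def)

lemma equiv_frac_rel: "equiv (carrier R \<times> S) (frac_rel R S)"
proof (rule equivI)
  show "frac_rel R S \<subseteq> (carrier R \<times> S) \<times> (carrier R \<times> S)"
    by (auto simp: frac_rel_def)
  show "refl_on (carrier R \<times> S) (frac_rel R S)"
    by (auto simp: refl_on_def frac_rel_def intro: S_mem)
  show "sym (frac_rel R S)"
    by (rule symI) (auto simp: frac_rel_def intro: sym)
  show "trans (frac_rel R S)"
  proof (rule transI, clarify)
    fix a s b t c w
    assume "((a, s), (b, t)) \<in> frac_rel R S" "((b, t), (c, w)) \<in> frac_rel R S"
    then obtain u v where uv: "u \<in> S" "v \<in> S" "u \<otimes> (a \<otimes> t) = u \<otimes> (b \<otimes> s)"
        "v \<otimes> (b \<otimes> w) = v \<otimes> (c \<otimes> t)"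
      and m: "a \<in> carrier R" "b \<in> carrier R" "c \<in> carrier R" "s \<in> S" "t \<in> S" "w \<in> S"
      by (auto simp: frac_rel_def)
    note c = uv(1,2)[THEN S_mem(1)] m(1-3) m(4-6)[THEN S_mem(1)]
    have "(u \<otimes> v \<otimes> t) \<otimes> (a \<otimes> w) = (u \<otimes> (a \<otimes> t)) \<otimes> (v \<otimes> w)"
      using c by (simp add: m_ac)
    also have "\<dots> = (u \<otimes> s) \<otimes> (v \<otimes> (b \<otimes> w))"
      unfolding uv(3) using c by (simp add: m_ac)
    also have "\<dots> = (u \<otimes> v \<otimes> t) \<otimes> (c \<otimes> s)"
      unfolding uv(4) using c by (simp add: m_ac)
    finally show "((a, s), (c, w)) \<in> frac_rel R S"
      using m uv(1,2) by (auto simp: frac_rel_def intro!: bexI[of _ "u \<otimes> v \<otimes> t"] S_mem)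
  qed
qed

lemma fraction_eq_iff:
  assumes "a \<in> carrier R" "s \<in> S" "b \<in> carrier R" "t \<in> S"
  shows "fraction R S a s = fraction R S b t \<longleftrightarrow> (\<exists>u\<in>S. u \<otimes> (a \<otimes> t) = u \<otimes> (b \<otimes> s))"
  using eq_equiv_class_iff[OF equiv_frac_rel, of "(a, s)" "(b, t)"] assms
  by (simp add: fraction_def frac_rel_def)

lemma localization_carrier:
  "carrier (localization R S) = {fraction R S a s | a s. a \<in> carrier R \<and> s \<in> S}"
  by (auto simp: localization_def quotient_def fraction_def)

lemma localization_mult:
  assumes "a \<in> carrier R" "s \<in> S" "b \<in> carrier R" "t \<in> S"
  shows "fraction R S a s \<otimes>\<^bsub>localization R S\<^esub> fraction R S b t = fraction R S (a \<otimes> b) (s \<otimes> t)"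
proof -
  let ?f = "\<lambda>(a, s) (b, t). fraction R S (a \<otimes> b) (s \<otimes> t)"
  have "congruent2 (frac_rel R S) (frac_rel R S) ?f"
  proof (rule congruent2_commuteI[OF equiv_frac_rel], goal_cases)
    case (1 y z)
    then show ?case by (auto simp: m_comm S_mem)
  next
    case (2 y z w)
    obtain a s b t c w' where e: "y = (a, s)" "z = (b, t)" "w = (c, w')"
      by (metis surj_pair)
    from 2 obtain u where u: "u \<in> S" "u \<otimes> (a \<otimes> t) = u \<otimes> (b \<otimes> s)"
      and m: "a \<in> carrier R" "b \<in> carrier R" "c \<in> carrier R" "s \<in> S" "t \<in> S" "w' \<in> S"
      by (auto simp: e frac_rel_def)
    note c = u(1)[THEN S_mem(1)] m(1-3) m(4-6)[THEN S_mem(1)]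
    have "u \<otimes> (c \<otimes> a \<otimes> (w' \<otimes> t)) = (u \<otimes> (a \<otimes> t)) \<otimes> (c \<otimes> w')"
      using c by (simp add: m_ac)
    also have "\<dots> = u \<otimes> (c \<otimes> b \<otimes> (w' \<otimes> s))"
      unfolding u(2) using c by (simp add: m_ac)
    finally show ?case using m u(1) by (auto simp: e fraction_eq_iff S_mem)
  qed
  from UN_equiv_class2[OF equiv_frac_rel equiv_frac_rel this, of "(a, s)" "(b, t)"] assms
  show ?thesis by (simp add: localization_def fraction_def case_prod_unfold)
qed

lemma localization_add:
  assumes "a \<in> carrier R" "s \<in> S" "b \<in> carrier R" "t \<in> S"
  shows "fraction R S a s \<oplus>\<^bsub>localization R S\<^esub> fraction R S b t
    = fraction R S (a \<otimes> t \<oplus> b \<otimes> s) (s \<otimes> t)"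
proof -
  let ?f = "\<lambda>(a, s) (b, t). fraction R S (a \<otimes> t \<oplus> b \<otimes> s) (s \<otimes> t)"
  have "congruent2 (frac_rel R S) (frac_rel R S) ?f"
  proof (rule congruent2_commuteI[OF equiv_frac_rel], goal_cases)
    case (1 y z)
    then show ?case by (auto simp: m_comm a_comm S_mem)
  next
    case (2 y z w)
    obtain a s b t c w' where e: "y = (a, s)" "z = (b, t)" "w = (c, w')"
      by (metis surj_pair)
    from 2 obtain u where u: "u \<in> S" "u \<otimes> (a \<otimes> t) = u \<otimes> (b \<otimes> s)"
      and m: "a \<in> carrier R" "b \<in> carrier R" "c \<in> carrier R" "s \<in> S" "t \<in> S" "w' \<in> S"
      by (auto simp: e frac_rel_def)
    note c = u(1)[THEN S_mem(1)] m(1-3) m(4-6)[THEN S_mem(1)]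
    have "u \<otimes> ((c \<otimes> s \<oplus> a \<otimes> w') \<otimes> (w' \<otimes> t))
        = u \<otimes> c \<otimes> s \<otimes> w' \<otimes> t \<oplus> (u \<otimes> (a \<otimes> t)) \<otimes> (w' \<otimes> w')"
      using c by (simp add: m_ac l_distr r_distr)
    also have "\<dots> = u \<otimes> ((c \<otimes> t \<oplus> b \<otimes> w') \<otimes> (w' \<otimes> s))"
      unfolding u(2) using c by (simp add: m_ac l_distr r_distr)
    finally show ?case using m u(1) by (auto simp: e fraction_eq_iff S_mem)
  qed
  from UN_equiv_class2[OF equiv_frac_rel equiv_frac_rel this, of "(a, s)" "(b, t)"] assms
  show ?thesis by (simp add: localization_def fraction_def case_prod_unfold)
qed

lemma localization_one_zero:
  "\<one>\<^bsub>localization R S\<^esub> = fraction R S \<one> \<one>" "\<zero>\<^bsub>localization R S\<^esub> = fraction R S \<zero> \<one>"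
  by (simp_all add: localization_def)

lemma fraction_eqI:
  assumes "a \<in> carrier R" "s \<in> S" "b \<in> carrier R" "t \<in> S" "a \<otimes> t = b \<otimes> s"
  shows "fraction R S a s = fraction R S b t"
  using assms by (auto simp: fraction_eq_iff intro: bexI[OF _ S_mem(2)])

lemma cring_localization: "cring (localization R S)"
proof -
  let ?L = "localization R S"
  note ops = localization_mult localization_add localization_one_zero S_mem
  have fracE: "\<exists>a s. x = fraction R S a s \<and> a \<in> carrier R \<and> s \<in> S"
    if "x \<in> carrier ?L" for x
    using that by (auto simp: localization_carrier)
  have fracI: "fraction R S a s \<in> carrier ?L" if "a \<in> carrier R" "s \<in> S" for a s
    using that by (auto simp: localization_carrier)
  have add: "abelian_group ?L"
  proof (rule abelian_groupI)
    fix x y assume "x \<in> carrier ?L" "y \<in> carrier ?L"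
    then obtain a s b t where e: "x = fraction R S a s" "a \<in> carrier R" "s \<in> S"
        "y = fraction R S b t" "b \<in> carrier R" "t \<in> S"
      using fracE by meson
    then show "x \<oplus>\<^bsub>?L\<^esub> y \<in> carrier ?L"
      by (simp add: ops fracI)
    from e show "x \<oplus>\<^bsub>?L\<^esub> y = y \<oplus>\<^bsub>?L\<^esub> x"
      by (simp add: ops m_comm a_comm)
    fix z assume "z \<in> carrier ?L"
    then obtain c w where "z = fraction R S c w" "c \<in> carrier R" "w \<in> S"
      using fracE by meson
    with e show "x \<oplus>\<^bsub>?L\<^esub> y \<oplus>\<^bsub>?L\<^esub> z = x \<oplus>\<^bsub>?L\<^esub> (y \<oplus>\<^bsub>?L\<^esub> z)"
      by (simp add: ops m_ac a_ac l_distr r_distr)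
  next
    show "\<zero>\<^bsub>?L\<^esub> \<in> carrier ?L"
      by (simp add: ops fracI)
  next
    fix x assume "x \<in> carrier ?L"
    then obtain a s where x: "x = fraction R S a s" "a \<in> carrier R" "s \<in> S"
      using fracE by meson
    then show "\<zero>\<^bsub>?L\<^esub> \<oplus>\<^bsub>?L\<^esub> x = x"
      by (simp add: ops)
    have "fraction R S (\<ominus> a) s \<oplus>\<^bsub>?L\<^esub> x = fraction R S \<zero> (s \<otimes> s)"
      using x by (simp add: ops l_minus l_neg)
    also have "\<dots> = \<zero>\<^bsub>?L\<^esub>"
      unfolding ops(3,4) by (rule fraction_eqI) (use x in \<open>simp_all add: S_mem\<close>)
    finally show "\<exists>y\<in>carrier ?L. y \<oplus>\<^bsub>?L\<^esub> x = \<zero>\<^bsub>?L\<^esub>"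
      using x by (blast intro: fracI)
  qed
  have mult: "Group.comm_monoid ?L"
  proof (rule comm_monoidI)
    fix x y assume "x \<in> carrier ?L" "y \<in> carrier ?L"
    then obtain a s b t where e: "x = fraction R S a s" "a \<in> carrier R" "s \<in> S"
        "y = fraction R S b t" "b \<in> carrier R" "t \<in> S"
      using fracE by meson
    then show "x \<otimes>\<^bsub>?L\<^esub> y \<in> carrier ?L"
      by (simp add: ops fracI)
    from e show "x \<otimes>\<^bsub>?L\<^esub> y = y \<otimes>\<^bsub>?L\<^esub> x"
      by (simp add: ops m_comm)
    fix z assume "z \<in> carrier ?L"
    then obtain c w where "z = fraction R S c w" "c \<in> carrier R" "w \<in> S"
      using fracE by meson
    with e show "x \<otimes>\<^bsub>?L\<^esub> y \<otimes>\<^bsub>?L\<^esub> z = x \<otimes>\<^bsub>?L\<^esub> (y \<otimes>\<^bsub>?L\<^esub> z)"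
      by (simp add: ops m_ac)
  next
    show "\<one>\<^bsub>?L\<^esub> \<in> carrier ?L"
      by (simp add: ops fracI)
  next
    fix x assume "x \<in> carrier ?L"
    then obtain a s where "x = fraction R S a s" "a \<in> carrier R" "s \<in> S"
      using fracE by meson
    then show "\<one>\<^bsub>?L\<^esub> \<otimes>\<^bsub>?L\<^esub> x = x"
      by (simp add: ops)
  qed
  show ?thesis
  proof (rule cringI[OF add mult])
    fix x y z assume "x \<in> carrier ?L" "y \<in> carrier ?L" "z \<in> carrier ?L"
    then obtain a s b t c w where e: "x = fraction R S a s" "a \<in> carrier R" "s \<in> S"
        "y = fraction R S b t" "b \<in> carrier R" "t \<in> S"
        "z = fraction R S c w" "c \<in> carrier R" "w \<in> S"
      using fracE by meson
    have "(x \<oplus>\<^bsub>?L\<^esub> y) \<otimes>\<^bsub>?L\<^esub> z = fraction R S ((a \<otimes> t \<oplus> b \<otimes> s) \<otimes> c) (s \<otimes> t \<otimes> w)"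
      using e by (simp add: ops)
    also have "\<dots> = fraction R S (a \<otimes> c \<otimes> (t \<otimes> w) \<oplus> b \<otimes> c \<otimes> (s \<otimes> w)) (s \<otimes> w \<otimes> (t \<otimes> w))"
      by (rule fraction_eqI) (use e in \<open>simp_all add: S_mem m_ac l_distr r_distr\<close>)
    also have "\<dots> = x \<otimes>\<^bsub>?L\<^esub> z \<oplus>\<^bsub>?L\<^esub> y \<otimes>\<^bsub>?L\<^esub> z"
      using e by (simp add: ops)
    finally show "(x \<oplus>\<^bsub>?L\<^esub> y) \<otimes>\<^bsub>?L\<^esub> z = x \<otimes>\<^bsub>?L\<^esub> z \<oplus>\<^bsub>?L\<^esub> y \<otimes>\<^bsub>?L\<^esub> z" .
  qed
qed

end

lemma submonoid_constant_term_one: "submonoid (constant_term_one R) (UP R)"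
proof -
  interpret P: UP_cring R "UP R"
    by unfold_locales
  show ?thesis
    by unfold_locales (auto simp: constant_term_one_def)
qed

lemma cring_anderson_ring: "cring (anderson_ring R)"
proof -
  interpret P: UP_cring R "UP R"
    by unfold_locales
  show ?thesis
    unfolding anderson_ring_def by (rule P.P.cring_localization[OF submonoid_constant_term_one])
qed

end

end

theory Submission
  imports Defs
begin

text \<open>
  The proof is a cycle (1) \<open>\<Longrightarrow>\<close> (2) \<open>\<Longrightarrow>\<close> (3) \<open>\<Longrightarrow>\<close> (1). Condition (1) says exactly that every
  ideal of \<open>R\<close> is generated by an idempotent (\<open>vnr_pir_iff_idempotent_generators\<close>), and in this
  form it is used and proved.

  Dimension is a side issue. A principal ideal ring, even one with zero divisors, has no chain of
  three primes (\<open>no_prime_chain_of_length_2\<close>), and over a nonzero ring \<open>R\<close> a prime \<open>M\<close> gives two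
  primes of \<open>R[X]\<close>, namely \<open>M[X]\<close> and the set of polynomials with constant coefficient in \<open>M\<close>.
  Both avoid the polynomials with constant term \<open>1\<close> and therefore extend to the Anderson ring.

  From (1) to (2): let \<open>I\<close> be an ideal of \<open>R[X]\<close>. The top coefficients of the elements of \<open>I\<close> of
  degree at most \<open>n\<close> form an ideal with an idempotent generator, and an element of \<open>I\<close> whose top
  coefficient is that idempotent can be used for division as if it were monic. Idempotents split
  \<open>R\<close> into components, and the dividing elements of different degrees are combined into one
  generator by using each of them on the component that the earlier ones leave out
  (\<open>below_principal\<close>). As in Hilbert's basis theorem, the process stops because the union of all
  ideals of top coefficients is generated by an element of one of them.

  From (2) to (3): every ideal of a localization is generated by its numerators.

  From (3) to (1): apply the hypothesis to the ideal of all fractions whose numerator has its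
  constant coefficient in a given ideal \<open>J\<close>. The constant coefficient \<open>c\<close> of a generator generates
  \<open>J\<close>, and since \<open>X\<close> lies in the ideal, comparing coefficients of degree \<open>0\<close> and \<open>1\<close> shows that
  \<open>c\<close> is a multiple of \<open>c\<^sup>2\<close>.
\<close>

section \<open>Ideals generated by idempotents\<close>

lemma (in cring) ideal_closures:
  assumes "ideal I R"
  shows "a \<in> I \<Longrightarrow> a \<in> carrier R" "\<zero> \<in> I" "a \<in> I \<Longrightarrow> b \<in> I \<Longrightarrow> a \<oplus> b \<in> I"
    "a \<in> I \<Longrightarrow> b \<in> I \<Longrightarrow> a \<ominus> b \<in> I" "a \<in> I \<Longrightarrow> x \<in> carrier R \<Longrightarrow> x \<otimes> a \<in> I"
proof -
  interpret ideal I R by fact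
  show "a \<in> I \<Longrightarrow> a \<in> carrier R" "\<zero> \<in> I" "a \<in> I \<Longrightarrow> b \<in> I \<Longrightarrow> a \<oplus> b \<in> I"
    "a \<in> I \<Longrightarrow> b \<in> I \<Longrightarrow> a \<ominus> b \<in> I" "a \<in> I \<Longrightarrow> x \<in> carrier R \<Longrightarrow> x \<otimes> a \<in> I"
    by (auto simp: a_minus_def I_l_closed)
qed

lemma (in cring) idealI_add_mult:
  assumes sub: "I \<subseteq> carrier R" and zero: "\<zero> \<in> I"
    and add: "\<And>a b. a \<in> I \<Longrightarrow> b \<in> I \<Longrightarrow> a \<oplus> b \<in> I"
    and mult: "\<And>a x. a \<in> I \<Longrightarrow> x \<in> carrier R \<Longrightarrow> x \<otimes> a \<in> I"
  shows "ideal I R"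
proof (rule idealI)
  show "subgroup I (add_monoid R)"
  proof (rule add.subgroupI)
    fix a assume a: "a \<in> I"
    then have "\<ominus> a = \<ominus> \<one> \<otimes> a"
      using sub by (simp add: l_minus subset_iff)
    then show "\<ominus> a \<in> I"
      using mult[OF a, of "\<ominus> \<one>"] by simp
  qed (use sub zero add in auto)
  fix a x assume "a \<in> I" "x \<in> carrier R"
  then show "x \<otimes> a \<in> I" "a \<otimes> x \<in> I"
    using mult[of a x] sub by (auto simp: m_comm subset_iff)
qed (rule ring_axioms)

lemma (in cring) principal_ideal_ring_iff:
  "principal_ideal_ring R \<longleftrightarrow>
    (\<forall>I. ideal I R \<longrightarrow> (\<exists>g\<in>I. \<forall>h\<in>I. \<exists>q\<in>carrier R. h = q \<otimes> g))" (is "_ \<longleftrightarrow> ?rhs")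
proof
  assume pir: "principal_ideal_ring R"
  show ?rhs
  proof (intro allI impI)
    fix I assume "ideal I R"
    then have "principalideal I R"
      using pir by (simp add: principal_ideal_ring_def)
    then obtain g where "g \<in> carrier R" "I = Idl {g}"
      using principalideal.generate by blast
    then have "g \<in> carrier R" "I = PIdl g"
      by (simp_all add: cgenideal_eq_genideal)
    then show "\<exists>g\<in>I. \<forall>h\<in>I. \<exists>q\<in>carrier R. h = q \<otimes> g"
      using cgenideal_self[of g] by (auto simp: cgenideal_def)
  qed
next
  assume rhs: ?rhs
  have "principalideal I R" if I: "ideal I R" for I
  proof -
    obtain g where g: "g \<in> I" "\<forall>h\<in>I. \<exists>q\<in>carrier R. h = q \<otimes> g"
      using rhs I by blast
    note cl = ideal_closures[OF I]
    have "I = PIdl g"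
      using g cl by (auto simp: cgenideal_def)
    then show ?thesis
      using cgenideal_is_principalideal[of g] g(1) cl by simp
  qed
  then show "principal_ideal_ring R"
    using cring_axioms by (simp add: principal_ideal_ring_def)
qed

text \<open>
  Condition (1) enters the proof only through this reformulation. If \<open>g\<close> generates an ideal
  and \<open>g\<^sup>2b = g\<close>, then \<open>bg\<close> is an idempotent with the same multiples. Conversely, if the
  idempotent \<open>e = ba\<close> generates the ideal of the multiples of \<open>a\<close>, then \<open>a = ae = a\<^sup>2b\<close>.
  Idempotence of \<open>e\<close> is the instance \<open>x = e\<close> of the condition.
\<close>

lemma (in cring) vnr_pir_iff_idempotent_generators:
  "von_neumann_regular_ring R \<and> principal_ideal_ring R \<longleftrightarrow>
    (\<forall>I. ideal I R \<longrightarrow> (\<exists>e\<in>I. \<forall>x\<in>I. x \<otimes> e = x))" (is "_ \<longleftrightarrow> ?rhs")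
proof
  assume A: "von_neumann_regular_ring R \<and> principal_ideal_ring R"
  show ?rhs
  proof (intro allI impI)
    fix I assume I: "ideal I R"
    note cl = ideal_closures[OF I]
    obtain g where g: "g \<in> I" "\<forall>h\<in>I. \<exists>q\<in>carrier R. h = q \<otimes> g"
      using A I by (auto simp: principal_ideal_ring_iff)
    obtain b where b: "b \<in> carrier R" "g [^] (2::nat) \<otimes> b = g"
      using A cl(1)[OF g(1)] by (auto simp: von_neumann_regular_ring_def)
    have gb: "g \<otimes> (b \<otimes> g) = g"
      using b cl(1)[OF g(1)] by (simp add: numeral_2_eq_2 m_ac)
    show "\<exists>e\<in>I. \<forall>x\<in>I. x \<otimes> e = x"
    proof (intro bexI ballI)
      fix x assume "x \<in> I"
      then obtain q where "q \<in> carrier R" "x = q \<otimes> g"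
        using g by blast
      then show "x \<otimes> (b \<otimes> g) = x"
        using gb b cl(1)[OF g(1)] by (simp add: m_assoc)
    qed (use g b cl in auto)
  qed
next
  assume rhs: ?rhs
  have "\<exists>b\<in>carrier R. a [^] (2::nat) \<otimes> b = a" if a: "a \<in> carrier R" for a
  proof -
    obtain e where e: "e \<in> PIdl a" "\<forall>x\<in>PIdl a. x \<otimes> e = x"
      using rhs cgenideal_ideal[OF a] by blast
    then obtain b where b: "b \<in> carrier R" "e = b \<otimes> a"
      by (auto simp: cgenideal_def)
    have "a \<otimes> e = a"
      using e cgenideal_self[OF a] by blast
    then show ?thesis
      using a b by (intro bexI[of _ b]) (simp_all add: numeral_2_eq_2 m_ac)
  qed
  moreover have "\<exists>g\<in>I. \<forall>h\<in>I. \<exists>q\<in>carrier R. h = q \<otimes> g" if "ideal I R" for I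
    using rhs that ideal_closures(1)[OF that] by metis
  ultimately show "von_neumann_regular_ring R \<and> principal_ideal_ring R"
    using cring_axioms by (auto simp: principal_ideal_ring_iff von_neumann_regular_ring_def)
qed

section \<open>Prime ideals and dimension\<close>

lemma (in primeideal) one_not_mem: "\<one> \<notin> I"
  using I_notcarr one_imp_carrier by blast

text \<open>
  Zorn's lemma gives an ideal that is maximal among those without \<open>\<one>\<close>, and maximal ideals
  are prime.
\<close>

lemma (in cring) exists_primeideal:
  assumes "\<one> \<noteq> \<zero>"
  shows "\<exists>M. primeideal M R"
proof -
  let ?A = "{I. ideal I R \<and> \<one> \<notin> I}"
  have "\<exists>M\<in>?A. \<forall>X\<in>?A. M \<subseteq> X \<longrightarrow> X = M"
  proof (rule subset_Zorn_nonempty)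
    show "?A \<noteq> {}"
      using assms zeroideal by blast
    fix C assume C: "C \<noteq> {}" "subset.chain ?A C"
    have id: "ideal I R" if "I \<in> C" for I
      using C that by (auto simp: subset_chain_def)
    have "ideal (\<Union>C) R"
    proof (rule idealI_add_mult)
      fix a b assume "a \<in> \<Union>C" "b \<in> \<Union>C"
      then obtain I J where "I \<in> C" "a \<in> I" "J \<in> C" "b \<in> J" by blast
      moreover from this have "I \<subseteq> J \<or> J \<subseteq> I"
        using C by (auto simp: subset_chain_def)
      ultimately show "a \<oplus> b \<in> \<Union>C"
        using ideal_closures(3)[OF id] by blast
    next
      show "\<Union>C \<subseteq> carrier R"
        using ideal_closures(1)[OF id] by blast
      show "\<zero> \<in> \<Union>C"
        using C(1) ideal_closures(2)[OF id] by blast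
    next
      fix a x assume "a \<in> \<Union>C" "x \<in> carrier R"
      then show "x \<otimes> a \<in> \<Union>C"
        using ideal_closures(5)[OF id] by blast
    qed
    then show "\<Union>C \<in> ?A"
      using C by (auto simp: subset_chain_def)
  qed
  then obtain M where M: "ideal M R" "\<one> \<notin> M"
    and max: "\<And>X. ideal X R \<Longrightarrow> \<one> \<notin> X \<Longrightarrow> M \<subseteq> X \<Longrightarrow> X = M"
    by blast
  have "maximalideal M R"
  proof (rule maximalidealI)
    fix J assume J: "ideal J R" "M \<subseteq> J"
    then show "J = M \<or> J = carrier R"
      using max[of J] ideal.one_imp_carrier[of J R] by blast
  qed (use M in auto)
  then show ?thesis
    using maximalideal_prime by blast
qed

text \<open>
  Write \<open>P1\<close> as the multiples of \<open>p\<close> and \<open>P2\<close> as the multiples of \<open>q\<close>. Then \<open>p = rq\<close> with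
  \<open>q\<close> outside \<open>P1\<close>, so \<open>r\<close> lies in \<open>P1\<close> and is some \<open>sp\<close>. Now \<open>p(1 - sq) = 0\<close> lies in \<open>P0\<close>,
  which does not contain \<open>p\<close>. Hence \<open>1 - sq\<close> lies in \<open>P0\<close>, so in \<open>P2\<close>, and \<open>P2\<close> contains \<open>1\<close>.
\<close>

lemma (in cring) no_prime_chain_of_length_2:
  assumes pir: "principal_ideal_ring R"
    and prime: "primeideal P0 R" "primeideal P1 R" "primeideal P2 R"
    and less: "P0 \<subset> P1" "P1 \<subset> P2"
  shows False
proof -
  have id: "ideal P0 R" "ideal P1 R" "ideal P2 R"
    using prime by (auto simp: primeideal_def)
  obtain p where p: "p \<in> P1" "\<forall>h\<in>P1. \<exists>q\<in>carrier R. h = q \<otimes> p"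
    using pir id by (auto simp: principal_ideal_ring_iff)
  obtain q where q: "q \<in> P2" "\<forall>h\<in>P2. \<exists>r\<in>carrier R. h = r \<otimes> q"
    using pir id by (auto simp: principal_ideal_ring_iff)
  note cl0 = ideal_closures[OF id(1)]
  note cl1 = ideal_closures[OF id(2)]
  note cl2 = ideal_closures[OF id(3)]
  obtain r where r: "r \<in> carrier R" "p = r \<otimes> q"
    using p q less by blast
  have "q \<notin> P1"
  proof
    assume "q \<in> P1"
    then have "r \<otimes> q \<in> P1" if "r \<in> carrier R" for r
      using cl1(5) that by simp
    then have "P2 \<subseteq> P1"
      using q(2) by auto
    then show False
      using less by blast
  qed
  moreover have "r \<otimes> q \<in> P1"
    using p(1) r(2) by simp
  ultimately have "r \<in> P1"
    using primeideal.I_prime[OF prime(2) r(1) cl2(1)[OF q(1)]] by blast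
  then obtain s where s: "s \<in> carrier R" "r = s \<otimes> p"
    using p by blast
  have c: "p \<in> carrier R" "q \<in> carrier R"
    by (simp_all add: cl1(1)[OF p(1)] cl2(1)[OF q(1)])
  have "p \<otimes> (\<one> \<ominus> s \<otimes> q) = p \<ominus> r \<otimes> q"
    using c s by algebra
  also have "\<dots> = \<zero>"
    using r(2) c(1) by (simp add: a_minus_def r_neg)
  finally have "p \<otimes> (\<one> \<ominus> s \<otimes> q) \<in> P0"
    using cl0(2) by simp
  moreover have "p \<notin> P0"
  proof
    assume "p \<in> P0"
    then have "r \<otimes> p \<in> P0" if "r \<in> carrier R" for r
      using cl0(5) that by simp
    then have "P1 \<subseteq> P0"
      using p(2) by auto
    then show False
      using less by blast
  qed
  ultimately have "\<one> \<ominus> s \<otimes> q \<in> P2"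
    using primeideal.I_prime[OF prime(1) c(1), of "\<one> \<ominus> s \<otimes> q"] c(2) s(1) less by auto
  then have "(\<one> \<ominus> s \<otimes> q) \<oplus> s \<otimes> q \<in> P2"
    by (rule cl2(3)[OF _ cl2(5)[OF q(1) s(1)]])
  moreover have "(\<one> \<ominus> s \<otimes> q) \<oplus> s \<otimes> q = \<one>"
    using c s by algebra
  ultimately show False
    using ideal.one_imp_carrier[OF id(3)] primeideal.I_notcarr[OF prime(3)] by simp
qed

text \<open>
  A principal ideal ring has dimension at most one, so one strict inclusion of primes determines
  the dimension.
\<close>

lemma (in cring) krull_dim_principal_ideal_ring:
  assumes pir: "principal_ideal_ring R"
    and prime: "primeideal P0 R" "primeideal P1 R" and less: "P0 \<subset> P1"
  shows "krull_dim R = 1"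
  unfolding krull_dim_def
proof (rule antisym)
  show "Sup {enat n | n. \<exists>p. (\<forall>i\<le>n. primeideal (p i) R) \<and> (\<forall>i<n. p i \<subset> p (Suc i))} \<le> 1"
  proof (rule Sup_least, clarify)
    fix n and p :: "nat \<Rightarrow> 'a set"
    assume p: "\<forall>i\<le>n. primeideal (p i) R" "\<forall>i<n. p i \<subset> p (Suc i)"
    have "n \<le> 1"
    proof (rule ccontr)
      assume "\<not> n \<le> 1"
      then show False
        using no_prime_chain_of_length_2[OF pir, of "p 0" "p 1" "p 2"] p
        by (simp add: numeral_2_eq_2)
    qed
    then show "enat n \<le> 1"
      by (simp add: one_enat_def)
  qed
  show "1 \<le> Sup {enat n | n. \<exists>p. (\<forall>i\<le>n. primeideal (p i) R) \<and> (\<forall>i<n. p i \<subset> p (Suc i))}"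
    by (rule Sup_upper)
      (use prime less in \<open>auto simp: one_enat_def intro!: exI[of _ "\<lambda>i. if i = 0 then P0 else P1"]\<close>)
qed

section \<open>Localizations\<close>

lemma (in cring) fraction_cases:
  assumes "x \<in> carrier (localization R S)" "submonoid S R"
  obtains a s where "a \<in> carrier R" "s \<in> S" "x = fraction R S a s"
  using assms by (auto simp: localization_carrier)

text \<open>
  The same fraction has numerators that differ by factors from \<open>S\<close>. Since no such factor lies in
  the prime \<open>P\<close>, membership of the numerator in \<open>P\<close> does not depend on the representation.
\<close>

lemma (in cring) fraction_mem_extension_iff:
  assumes S: "submonoid S R" and P: "primeideal P R" and disj: "P \<inter> S = {}"
    and a: "a \<in> carrier R" "s \<in> S"
  shows "fraction R S a s \<in> {fraction R S b t | b t. b \<in> P \<and> t \<in> S} \<longleftrightarrow> a \<in> P"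
proof
  have id: "ideal P R"
    using P by (simp add: primeideal_def)
  note cl = ideal_closures[OF id]
  note S_cl = S_mem[OF S]
  assume "fraction R S a s \<in> {fraction R S b t | b t. b \<in> P \<and> t \<in> S}"
  then obtain b t where bt: "b \<in> P" "t \<in> S" "fraction R S a s = fraction R S b t"
    by blast
  then obtain u where u: "u \<in> S" "u \<otimes> (a \<otimes> t) = u \<otimes> (b \<otimes> s)"
    using fraction_eq_iff[OF S a cl(1)[OF bt(1)] bt(2)] by blast
  have "u \<otimes> t \<otimes> a = u \<otimes> s \<otimes> b"
    using u bt a S_cl cl(1)[OF bt(1)] by (simp add: m_ac)
  then have "u \<otimes> t \<otimes> a \<in> P"
    using cl(5)[OF bt(1), of "u \<otimes> s"] u(1) a S_cl(1) by simp
  moreover have "u \<otimes> t \<notin> P"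
    using disj S_cl(3)[OF u(1) bt(2)] by blast
  ultimately show "a \<in> P"
    using primeideal.I_prime[OF P S_cl(1)[OF S_cl(3)[OF u(1) bt(2)]] a(1)] by blast
qed (use a in blast)

lemma (in cring) primeideal_localization:
  assumes S: "submonoid S R" and P: "primeideal P R" and disj: "P \<inter> S = {}"
  shows "primeideal {fraction R S b t | b t. b \<in> P \<and> t \<in> S} (localization R S)" (is "primeideal ?E ?L")
proof -
  interpret L: cring ?L
    by (rule cring_localization[OF S])
  have id: "ideal P R"
    using P by (simp add: primeideal_def)
  note cl = ideal_closures[OF id]
  note S_cl = S_mem[OF S]
  note mem = fraction_mem_extension_iff[OF S P disj]
  note ops = localization_mult[OF S] localization_add[OF S] localization_one_zero[OF S]
  show ?thesis
  proof (rule primeidealI)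
    show "ideal ?E ?L"
    proof (rule L.idealI_add_mult)
      show "?E \<subseteq> carrier ?L"
        using cl(1) by (auto simp: localization_carrier[OF S])
      show "\<zero>\<^bsub>?L\<^esub> \<in> ?E"
        using cl(2) S_cl(2) by (auto simp: ops)
    next
      fix x y assume "x \<in> ?E" "y \<in> ?E"
      then obtain a s b t where x: "a \<in> P" "s \<in> S" "x = fraction R S a s"
        and y: "b \<in> P" "t \<in> S" "y = fraction R S b t"
        by blast
      have "t \<otimes> a \<oplus> s \<otimes> b \<in> P"
        by (intro cl(3,5) S_cl(1) x y)
      moreover have "x \<oplus>\<^bsub>?L\<^esub> y = fraction R S (t \<otimes> a \<oplus> s \<otimes> b) (s \<otimes> t)"
        using x y cl(1)[OF x(1)] cl(1)[OF y(1)] S_cl(1) by (simp add: ops m_comm)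
      ultimately show "x \<oplus>\<^bsub>?L\<^esub> y \<in> ?E"
        using S_cl(3)[OF x(2) y(2)] by blast
    next
      fix x y assume "x \<in> ?E" and y: "y \<in> carrier ?L"
      then obtain a s where x: "a \<in> P" "s \<in> S" "x = fraction R S a s"
        by blast
      obtain b t where b: "b \<in> carrier R" "t \<in> S" "y = fraction R S b t"
        using y S by (rule fraction_cases)
      have "y \<otimes>\<^bsub>?L\<^esub> x = fraction R S (b \<otimes> a) (t \<otimes> s)"
        using x b cl(1)[OF x(1)] by (simp add: ops)
      then show "y \<otimes>\<^bsub>?L\<^esub> x \<in> ?E"
        using cl(5)[OF x(1) b(1)] S_cl(3)[OF b(2) x(2)] by blast
    qed
    show "cring ?L" by (rule L.cring_axioms)
    have "\<one> \<notin> P"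
      using disj S_cl(2) by blast
    then have "\<one>\<^bsub>?L\<^esub> \<notin> ?E"
      unfolding ops by (subst mem) (auto simp: S_cl(2))
    then show "carrier ?L \<noteq> ?E"
      using L.one_closed by blast
  next
    fix x y assume x: "x \<in> carrier ?L" and y: "y \<in> carrier ?L" and xy: "x \<otimes>\<^bsub>?L\<^esub> y \<in> ?E"
    from x obtain a s where a: "a \<in> carrier R" "s \<in> S" "x = fraction R S a s"
      using S by (rule fraction_cases)
    from y obtain b t where b: "b \<in> carrier R" "t \<in> S" "y = fraction R S b t"
      using S by (rule fraction_cases)
    have "a \<otimes> b \<in> P"
      using xy a b S_cl(3)[OF a(2) b(2)] by (simp add: ops mem del: mem_Collect_eq)
    then have "a \<in> P \<or> b \<in> P"
      using primeideal.I_prime[OF P a(1) b(1)] by blast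
    then show "x \<in> ?E \<or> y \<in> ?E"
      using a b by blast
  qed
qed

text \<open>
  If \<open>g\<close> generates the ideal of all \<open>a\<close> with \<open>a/1\<close> in \<open>J\<close>, then \<open>g/1\<close> generates \<open>J\<close>: from
  \<open>a/s\<close> in \<open>J\<close> one gets \<open>a/1 = (s/1)(a/s)\<close> in \<open>J\<close>, and \<open>a = qg\<close> gives \<open>a/s = (q/s)(g/1)\<close>.
\<close>

lemma (in cring) principal_ideal_ring_localization:
  assumes S: "submonoid S R" and pir: "principal_ideal_ring R"
  shows "principal_ideal_ring (localization R S)" (is "principal_ideal_ring ?L")
proof -
  interpret L: cring ?L
    by (rule cring_localization[OF S])
  note S_cl = S_mem[OF S]
  note ops = localization_mult[OF S] localization_add[OF S] localization_one_zero[OF S]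
  have "\<exists>g\<in>J. \<forall>h\<in>J. \<exists>q\<in>carrier ?L. h = q \<otimes>\<^bsub>?L\<^esub> g" if J: "ideal J ?L" for J
  proof -
    note cl = L.ideal_closures[OF J]
    have frac: "fraction R S a s \<in> carrier ?L" if "a \<in> carrier R" "s \<in> S" for a s
      using that by (auto simp: localization_carrier[OF S])
    let ?I = "{a \<in> carrier R. fraction R S a \<one> \<in> J}"
    have "ideal ?I R"
    proof (rule idealI_add_mult)
      show "\<zero> \<in> ?I"
        using cl(2) by (simp add: ops)
    next
      fix a b assume "a \<in> ?I" "b \<in> ?I"
      then show "a \<oplus> b \<in> ?I"
        using cl(3)[of "fraction R S a \<one>" "fraction R S b \<one>"] by (simp add: ops S_cl)
    next
      fix a x assume "a \<in> ?I" "x \<in> carrier R"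
      then show "x \<otimes> a \<in> ?I"
        using cl(5)[of "fraction R S a \<one>" "fraction R S x \<one>"] by (simp add: ops S_cl frac)
    qed auto
    then obtain g where g: "g \<in> ?I" "\<forall>h\<in>?I. \<exists>q\<in>carrier R. h = q \<otimes> g"
      using pir unfolding principal_ideal_ring_iff by blast
    show ?thesis
    proof (rule bexI[of _ "fraction R S g \<one>"], rule ballI)
      fix h assume h: "h \<in> J"
      obtain a s where a: "a \<in> carrier R" "s \<in> S" "h = fraction R S a s"
        using cl(1)[OF h] S by (rule fraction_cases)
      have "fraction R S s \<one> \<otimes>\<^bsub>?L\<^esub> h \<in> J"
        using h a by (intro cl frac) (auto simp: S_cl)
      also have "fraction R S s \<one> \<otimes>\<^bsub>?L\<^esub> h = fraction R S (s \<otimes> a) s"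
        using a S_cl by (simp add: ops)
      also have "\<dots> = fraction R S a \<one>"
        using a S_cl by (intro fraction_eqI[OF S]) (simp_all add: m_comm)
      finally obtain q where q: "q \<in> carrier R" "a = q \<otimes> g"
        using g a by blast
      have "h = fraction R S q s \<otimes>\<^bsub>?L\<^esub> fraction R S g \<one>"
        using q a g S_cl by (simp add: ops)
      then show "\<exists>q\<in>carrier ?L. h = q \<otimes>\<^bsub>?L\<^esub> fraction R S g \<one>"
        using q a frac by blast
    qed (use g in auto)
  qed
  then show ?thesis
    by (simp add: L.principal_ideal_ring_iff)
qed

section \<open>Prime ideals of the polynomial ring\<close>

lemma (in cring) finsum_mem_ideal:
  assumes I: "ideal I R" and "finite A" and "\<And>i. i \<in> A \<Longrightarrow> f i \<in> I"
  shows "(\<Oplus>i\<in>A. f i) \<in> I"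
  using assms(2,3)
proof (induction A rule: finite_induct)
  case empty
  then show ?case
    using ideal_closures(2)[OF I] by simp
next
  case (insert a A)
  have "f \<in> A \<rightarrow> carrier R" "f a \<in> carrier R"
    using insert.prems ideal_closures(1)[OF I] by auto
  then show ?case
    using insert ideal_closures(3)[OF I] by simp
qed

context UP_cring
begin

lemma coeff_mult_0:
  assumes "f \<in> carrier P" "g \<in> carrier P"
  shows "coeff P (f \<otimes>\<^bsub>P\<^esub> g) 0 = coeff P f 0 \<otimes> coeff P g 0"
  using assms by simp

lemma coeff_mult_1:
  assumes "f \<in> carrier P" "g \<in> carrier P"
  shows "coeff P (f \<otimes>\<^bsub>P\<^esub> g) 1 = coeff P f 0 \<otimes> coeff P g 1 \<oplus> coeff P f 1 \<otimes> coeff P g 0"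
  using assms by (simp add: R.a_comm)

lemma primeideal_constant_coeff:
  assumes M: "primeideal M R"
  shows "primeideal {f \<in> carrier P. coeff P f 0 \<in> M} P"
proof -
  have id: "ideal M R"
    using M by (simp add: primeideal_def)
  note cl = R.ideal_closures[OF id]
  note one = primeideal.one_not_mem[OF M]
  show ?thesis
  proof (rule primeidealI)
    show "ideal {f \<in> carrier P. coeff P f 0 \<in> M} P"
      by (rule P.idealI_add_mult) (auto simp: cl coeff_mult_0 simp del: coeff_mult)
    have "\<one>\<^bsub>P\<^esub> \<notin> {f \<in> carrier P. coeff P f 0 \<in> M}"
      using one by simp
    then show "carrier P \<noteq> {f \<in> carrier P. coeff P f 0 \<in> M}"
      using P.one_closed by blast
  next
    fix f g assume "f \<in> carrier P" "g \<in> carrier P" "f \<otimes>\<^bsub>P\<^esub> g \<in> {f \<in> carrier P. coeff P f 0 \<in> M}"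
    then show "f \<in> {f \<in> carrier P. coeff P f 0 \<in> M} \<or> g \<in> {f \<in> carrier P. coeff P f 0 \<in> M}"
      using primeideal.I_prime[OF M, of "coeff P f 0" "coeff P g 0"]
      by (simp add: coeff_mult_0 del: coeff_mult)
  qed (rule P.cring_axioms)
qed

text \<open>
  This is the ideal \<open>M[X]\<close>. It is prime by the argument of Gauss's lemma: if \<open>m\<close> and \<open>n\<close> are the
  first positions where \<open>f\<close> and \<open>g\<close> have coefficients outside \<open>M\<close>, then the coefficient of
  \<open>fg\<close> at \<open>m + n\<close> is congruent to \<open>f\<^sub>mg\<^sub>n\<close> modulo \<open>M\<close>.
\<close>

lemma primeideal_all_coeffs:
  assumes M: "primeideal M R"
  shows "primeideal {f \<in> carrier P. \<forall>i. coeff P f i \<in> M} P" (is "primeideal ?M P")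
proof -
  have id: "ideal M R"
    using M by (simp add: primeideal_def)
  note cl = R.ideal_closures[OF id]
  note one = primeideal.one_not_mem[OF M]
  show ?thesis
  proof (rule primeidealI)
    show "ideal ?M P"
      by (rule P.idealI_add_mult) (auto simp: cl intro!: R.finsum_mem_ideal[OF id])
    have "\<one>\<^bsub>P\<^esub> \<notin> ?M"
      using one by (auto intro!: exI[of _ 0])
    then show "carrier P \<noteq> ?M"
      using P.one_closed by blast
  next
    fix f g assume f: "f \<in> carrier P" and g: "g \<in> carrier P" and fg: "f \<otimes>\<^bsub>P\<^esub> g \<in> ?M"
    show "f \<in> ?M \<or> g \<in> ?M"
    proof (rule ccontr)
      assume "\<not> ?thesis"
      then have ex: "\<exists>i. coeff P f i \<notin> M" "\<exists>j. coeff P g j \<notin> M"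
        using f g by auto
      define m where "m = (LEAST i. coeff P f i \<notin> M)"
      define n where "n = (LEAST j. coeff P g j \<notin> M)"
      have m: "coeff P f m \<notin> M" "\<And>i. i < m \<Longrightarrow> coeff P f i \<in> M"
        using LeastI_ex[OF ex(1)] not_less_Least unfolding m_def by blast+
      have n: "coeff P g n \<notin> M" "\<And>j. j < n \<Longrightarrow> coeff P g j \<in> M"
        using LeastI_ex[OF ex(2)] not_less_Least unfolding n_def by blast+
      let ?t = "\<lambda>i. coeff P f i \<otimes> coeff P g (m + n - i)"
      have t: "?t i \<in> carrier R" for i
        using f g by simp
      have rest: "(\<Oplus>i\<in>{..m + n} - {m}. ?t i) \<in> M"
      proof (rule R.finsum_mem_ideal[OF id])
        fix i assume i: "i \<in> {..m + n} - {m}"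
        show "?t i \<in> M"
        proof (cases "i < m")
          case True
          then show ?thesis
            using cl(5)[OF m(2)[OF True], of "coeff P g (m + n - i)"] f g by (simp add: R.m_comm)
        next
          case False
          then have "m + n - i < n"
            using i by auto
          then show ?thesis
            using cl(5)[OF n(2), of _ "coeff P f i"] f by simp
        qed
      qed simp
      have "coeff P (f \<otimes>\<^bsub>P\<^esub> g) (m + n) = (\<Oplus>i\<in>insert m ({..m + n} - {m}). ?t i)"
        using f g by (simp add: insert_absorb)
      also have "\<dots> = ?t m \<oplus> (\<Oplus>i\<in>{..m + n} - {m}. ?t i)"
        by (rule R.finsum_insert) (use f g in auto)
      finally have "?t m = coeff P (f \<otimes>\<^bsub>P\<^esub> g) (m + n) \<ominus> (\<Oplus>i\<in>{..m + n} - {m}. ?t i)"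
        using f g cl(1)[OF rest] by (simp add: a_minus_def R.a_assoc R.r_neg)
      moreover have "coeff P (f \<otimes>\<^bsub>P\<^esub> g) (m + n) \<in> M"
        using fg by blast
      ultimately have "coeff P f m \<otimes> coeff P g n \<in> M"
        using cl(4)[OF _ rest] by simp
      then show False
        using primeideal.I_prime[OF M coeff_closed[OF f] coeff_closed[OF g]] m(1) n(1) by blast
    qed
  qed (rule P.cring_axioms)
qed

text \<open>
  The indeterminate separates \<open>M[X]\<close> from the preimage of \<open>M\<close> under evaluation at zero.
\<close>

lemma coeff_ideals_less:
  assumes M: "primeideal M R"
  shows "{f \<in> carrier P. \<forall>i. coeff P f i \<in> M} \<subset> {f \<in> carrier P. coeff P f 0 \<in> M}"
proof -
  have id: "ideal M R"
    using M by (simp add: primeideal_def)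
  note one = primeideal.one_not_mem[OF M]
  have "monom P \<one> 1 \<in> {f \<in> carrier P. coeff P f 0 \<in> M}"
    using R.ideal_closures(2)[OF id] by simp
  moreover have "monom P \<one> 1 \<notin> {f \<in> carrier P. \<forall>i. coeff P f i \<in> M}"
    using one by (auto intro!: exI[of _ 1])
  ultimately show ?thesis
    by blast
qed

lemma krull_dim_polynomials:
  assumes "\<one> \<noteq> \<zero>" and "principal_ideal_ring P"
  shows "krull_dim P = 1"
proof -
  obtain M where M: "primeideal M R"
    using R.exists_primeideal assms by blast
  show ?thesis
    by (rule P.krull_dim_principal_ideal_ring[OF assms(2) primeideal_all_coeffs[OF M]
        primeideal_constant_coeff[OF M] coeff_ideals_less[OF M]])
qed

section \<open>Polynomials over a ring with idempotent generators\<close>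

definition below :: "(nat \<Rightarrow> 'a) set \<Rightarrow> nat \<Rightarrow> (nat \<Rightarrow> 'a) set" where
  "below I n = {f \<in> I. \<forall>i\<ge>n. coeff P f i = \<zero>}"

text \<open>
  The coefficient at \<open>n\<close> may vanish, so this is the set of leading coefficients of the elements of
  degree \<open>n\<close> of \<open>I\<close>, together with zero.
\<close>

definition top_coeffs :: "(nat \<Rightarrow> 'a) set \<Rightarrow> nat \<Rightarrow> 'a set" where
  "top_coeffs I n = (\<lambda>f. coeff P f n) ` below I (Suc n)"

context
  fixes I
  assumes I: "ideal I P"
begin

lemma below_closures:
  "f \<in> below I n \<Longrightarrow> f \<in> carrier P" "\<zero>\<^bsub>P\<^esub> \<in> below I n"
  "f \<in> below I n \<Longrightarrow> g \<in> below I n \<Longrightarrow> f \<oplus>\<^bsub>P\<^esub> g \<in> below I n"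
  "f \<in> below I n \<Longrightarrow> g \<in> below I n \<Longrightarrow> f \<ominus>\<^bsub>P\<^esub> g \<in> below I n"
  using P.ideal_closures[OF I] by (auto simp: below_def a_minus_def R.r_neg)

lemma below_shift:
  assumes f: "f \<in> below I n" and a: "a \<in> carrier R"
  shows "monom P a k \<otimes>\<^bsub>P\<^esub> f \<in> below I (n + k)"
    and "coeff P (monom P a k \<otimes>\<^bsub>P\<^esub> f) (m + k) = a \<otimes> coeff P f m"
proof -
  note cl = P.ideal_closures[OF I]
  have fP: "f \<in> carrier P" and fI: "f \<in> I"
    using f cl(1) by (auto simp: below_def)
  show c: "coeff P (monom P a k \<otimes>\<^bsub>P\<^esub> f) (m + k) = a \<otimes> coeff P f m" for m
    by (rule coeff_monom_mult[OF a fP])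
  have "coeff P (monom P a k \<otimes>\<^bsub>P\<^esub> f) i = \<zero>" if "i \<ge> n + k" for i
    using c[of "i - k"] that f a by (simp add: below_def del: coeff_mult)
  then show "monom P a k \<otimes>\<^bsub>P\<^esub> f \<in> below I (n + k)"
    using cl(5)[OF fI] a by (simp add: below_def del: coeff_mult)
qed

lemma ideal_top_coeffs: "ideal (top_coeffs I n) R"
proof (rule R.idealI_add_mult)
  show "top_coeffs I n \<subseteq> carrier R"
    using below_closures(1) by (auto simp: top_coeffs_def)
  show "\<zero> \<in> top_coeffs I n"
    using below_closures(2)[of "Suc n"] by (force simp: top_coeffs_def)
next
  fix a b assume "a \<in> top_coeffs I n" "b \<in> top_coeffs I n"
  then obtain f g where fg: "f \<in> below I (Suc n)" "a = coeff P f n" "g \<in> below I (Suc n)" "b = coeff P g n"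
    by (auto simp: top_coeffs_def)
  then have "a \<oplus> b = coeff P (f \<oplus>\<^bsub>P\<^esub> g) n"
    using below_closures(1) by simp
  then show "a \<oplus> b \<in> top_coeffs I n"
    using below_closures(3)[OF fg(1,3)] by (auto simp: top_coeffs_def)
next
  fix a x assume "a \<in> top_coeffs I n" and x: "x \<in> carrier R"
  then obtain f where f: "f \<in> below I (Suc n)" "a = coeff P f n"
    by (auto simp: top_coeffs_def)
  then have "x \<otimes> a = coeff P (monom P x 0 \<otimes>\<^bsub>P\<^esub> f) n"
    using below_shift(2)[OF f(1) x, of 0 n] by simp
  then show "x \<otimes> a \<in> top_coeffs I n"
    using below_shift(1)[OF f(1) x, of 0] by (auto simp: top_coeffs_def)
qed

lemma top_coeffs_mono:
  assumes "m \<le> n"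
  shows "top_coeffs I m \<subseteq> top_coeffs I n"
proof
  fix a assume "a \<in> top_coeffs I m"
  then obtain f where f: "f \<in> below I (Suc m)" "a = coeff P f m"
    by (auto simp: top_coeffs_def)
  have "coeff P (monom P \<one> (n - m) \<otimes>\<^bsub>P\<^esub> f) n = a"
    using below_shift(2)[OF f(1) R.one_closed, of "n - m" m] below_closures(1)[OF f(1)] assms f(2)
    by simp
  moreover have "monom P \<one> (n - m) \<otimes>\<^bsub>P\<^esub> f \<in> below I (Suc n)"
    using below_shift(1)[OF f(1) R.one_closed, of "n - m"] assms by simp
  ultimately show "a \<in> top_coeffs I n"
    unfolding top_coeffs_def by blast
qed

text \<open>
  One step of division by \<open>f\<close>, which need not be monic: it is enough that its top coefficient
  acts as an identity on the coefficient to be cancelled.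
\<close>

lemma cancel_top_coeff:
  assumes h: "h \<in> below I (Suc n)" and f: "f \<in> below I (Suc m)" and "m \<le> n"
    and unit: "coeff P h n \<otimes> coeff P f m = coeff P h n"
  shows "h \<ominus>\<^bsub>P\<^esub> monom P (coeff P h n) (n - m) \<otimes>\<^bsub>P\<^esub> f \<in> below I n"
proof -
  let ?r = "monom P (coeff P h n) (n - m) \<otimes>\<^bsub>P\<^esub> f"
  have hn: "coeff P h n \<in> carrier R"
    using below_closures(1)[OF h] by simp
  have r: "?r \<in> below I (Suc n)" "coeff P ?r n = coeff P h n"
    using below_shift[OF f hn, of "n - m"] below_shift(2)[OF f hn, of "n - m" m] assms(3) unit
    by simp_all
  have "coeff P (h \<ominus>\<^bsub>P\<^esub> ?r) n = coeff P h n \<ominus> coeff P ?r n"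
    using below_closures(1)[OF h] below_closures(1)[OF r(1)] by simp
  also have "\<dots> = \<zero>"
    unfolding r(2) using hn by (simp add: a_minus_def R.r_neg)
  finally have "coeff P (h \<ominus>\<^bsub>P\<^esub> ?r) n = \<zero>" .
  then show ?thesis
    using below_closures(4)[OF h r(1)] unfolding below_def
    by (auto simp: not_less_eq_eq[symmetric] le_Suc_eq dest: le_neq_implies_less)
qed

context
  assumes idem: "\<And>J. ideal J R \<Longrightarrow> \<exists>e\<in>J. \<forall>x\<in>J. x \<otimes> e = x"
begin

text \<open>
  The generator \<open>g\<close> is built up degree by degree. For the passage from \<open>n\<close>
  to \<open>n + 1\<close>, let \<open>e\<close> be the idempotent generator of the top coefficients
  at \<open>n\<close>, and \<open>F = eF\<close> an element of \<open>I\<close> with top coefficient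
  \<open>e\<close>. The induction carries an idempotent \<open>c\<close> with \<open>cg = g\<close>,
  and \<open>c\<close> is the coefficient at \<open>n\<close> of a multiple of \<open>g\<close>. So
  \<open>g\<close> is kept on the component of \<open>R\<close> cut out by \<open>c\<close>, and on
  the complement it is supplemented by \<open>F\<close>: \<open>g' = g + (1 - c)F\<close>. Then
  \<open>cg' = g\<close> and \<open>(1 - c)g' = (1 - c)F\<close>, so the multiples of
  \<open>g'\<close> include those of \<open>g\<close> and also one with top coefficient \<open>c +
  (1 - c)e = e\<close>, and this one cancels every coefficient at \<open>n\<close>.
\<close>

lemma below_principal:
  "\<exists>g c q. g \<in> I \<and> c \<in> carrier R \<and> c \<otimes> c = c \<and> monom P c 0 \<otimes>\<^bsub>P\<^esub> g = g \<and> q \<in> carrier P \<and>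
     q \<otimes>\<^bsub>P\<^esub> g \<in> below I (Suc n) \<and> coeff P (q \<otimes>\<^bsub>P\<^esub> g) n = c \<and>
     (\<forall>h\<in>below I n. \<exists>r\<in>carrier P. h = r \<otimes>\<^bsub>P\<^esub> g)"
proof (induction n)
  case 0
  have "h = \<zero>\<^bsub>P\<^esub>" if "h \<in> below I 0" for h
    by (rule up_eqI) (use that below_closures(1) in \<open>auto simp: below_def\<close>)
  then have "\<forall>h\<in>below I 0. \<exists>r\<in>carrier P. h = r \<otimes>\<^bsub>P\<^esub> \<zero>\<^bsub>P\<^esub>"
    by (metis P.r_null P.zero_closed)
  moreover have "\<zero>\<^bsub>P\<^esub> \<otimes>\<^bsub>P\<^esub> \<zero>\<^bsub>P\<^esub> \<in> below I (Suc 0)" "coeff P (\<zero>\<^bsub>P\<^esub> \<otimes>\<^bsub>P\<^esub> \<zero>\<^bsub>P\<^esub>) 0 = \<zero>"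
    "monom P \<zero> 0 \<otimes>\<^bsub>P\<^esub> \<zero>\<^bsub>P\<^esub> = \<zero>\<^bsub>P\<^esub>" "\<zero> \<otimes> \<zero> = \<zero>"
    using below_closures(2)[of "Suc 0"] by simp_all
  ultimately show ?case
    using P.ideal_closures(2)[OF I] P.zero_closed R.zero_closed by blast
next
  case (Suc n)
  note cl = P.ideal_closures[OF I]
  obtain g c q where g: "g \<in> I" and c: "c \<in> carrier R" "c \<otimes> c = c"
    and cg: "monom P c 0 \<otimes>\<^bsub>P\<^esub> g = g" and q: "q \<in> carrier P" "q \<otimes>\<^bsub>P\<^esub> g \<in> below I (Suc n)"
      "coeff P (q \<otimes>\<^bsub>P\<^esub> g) n = c"
    and gen: "\<forall>h\<in>below I n. \<exists>r\<in>carrier P. h = r \<otimes>\<^bsub>P\<^esub> g"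
    using Suc.IH by blast
  obtain e where e: "e \<in> top_coeffs I n" "\<forall>x\<in>top_coeffs I n. x \<otimes> e = x"
    using idem[OF ideal_top_coeffs] by blast
  have eR: "e \<in> carrier R" and ee: "e \<otimes> e = e"
    using e R.ideal_closures(1)[OF ideal_top_coeffs] by auto
  have "c \<in> top_coeffs I n"
    using q(2,3) unfolding top_coeffs_def by blast
  then have ce: "c \<otimes> e = c"
    using e by blast
  obtain f where f: "f \<in> below I (Suc n)" "coeff P f n = e"
    using e(1) by (auto simp: top_coeffs_def)
  define \<epsilon> \<gamma> where "\<epsilon> = monom P e 0" and "\<gamma> = monom P c 0"
  have \<epsilon>\<gamma>: "\<epsilon> \<in> carrier P" "\<gamma> \<in> carrier P" "\<epsilon> \<otimes>\<^bsub>P\<^esub> \<epsilon> = \<epsilon>" "\<gamma> \<otimes>\<^bsub>P\<^esub> \<gamma> = \<gamma>" "\<gamma> \<otimes>\<^bsub>P\<^esub> \<epsilon> = \<gamma>"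
    using c eR ee ce monom_mult[of e e 0 0] monom_mult[of c c 0 0] monom_mult[of c e 0 0]
    by (simp_all add: \<epsilon>_def \<gamma>_def)
  define F where "F = \<epsilon> \<otimes>\<^bsub>P\<^esub> f"
  have F: "F \<in> below I (Suc n)" "coeff P F n = e" "F \<in> carrier P"
    using below_shift[OF f(1) eR, of 0] f(2) ee below_closures(1) by (auto simp: F_def \<epsilon>_def)
  have \<epsilon>F: "\<epsilon> \<otimes>\<^bsub>P\<^esub> F = F"
    using \<epsilon>\<gamma> below_closures(1)[OF f(1)] by (simp add: F_def P.m_assoc[symmetric])
  have gP: "g \<in> carrier P"
    using cl(1)[OF g] .
  have \<gamma>g: "\<gamma> \<otimes>\<^bsub>P\<^esub> g = g"
    using cg by (simp add: \<gamma>_def)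
  have \<gamma>F: "\<gamma> \<otimes>\<^bsub>P\<^esub> F \<in> below I (Suc n)" "coeff P (\<gamma> \<otimes>\<^bsub>P\<^esub> F) n = c"
    using below_shift[OF F(1) c(1), of 0] F(2) ce by (simp_all add: \<gamma>_def)
  define g' where "g' = g \<oplus>\<^bsub>P\<^esub> (F \<ominus>\<^bsub>P\<^esub> \<gamma> \<otimes>\<^bsub>P\<^esub> F)"
  have g'I: "g' \<in> I"
    using g F \<gamma>F cl by (auto simp: g'_def below_def)
  have g'P: "g' \<in> carrier P"
    using cl(1)[OF g'I] .
  have "\<gamma> \<otimes>\<^bsub>P\<^esub> g' = \<gamma> \<otimes>\<^bsub>P\<^esub> g \<oplus>\<^bsub>P\<^esub> (\<gamma> \<otimes>\<^bsub>P\<^esub> F \<ominus>\<^bsub>P\<^esub> (\<gamma> \<otimes>\<^bsub>P\<^esub> \<gamma>) \<otimes>\<^bsub>P\<^esub> F)"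
    unfolding g'_def using gP F(3) \<epsilon>\<gamma>(1,2) by algebra
  then have \<gamma>g': "\<gamma> \<otimes>\<^bsub>P\<^esub> g' = g"
    using gP F(3) \<epsilon>\<gamma> \<gamma>g by (simp add: a_minus_def P.r_neg)
  have "\<epsilon> \<otimes>\<^bsub>P\<^esub> g' = \<epsilon> \<otimes>\<^bsub>P\<^esub> g \<oplus>\<^bsub>P\<^esub> (\<epsilon> \<otimes>\<^bsub>P\<^esub> F \<ominus>\<^bsub>P\<^esub> \<gamma> \<otimes>\<^bsub>P\<^esub> (\<epsilon> \<otimes>\<^bsub>P\<^esub> F))"
    unfolding g'_def using gP F(3) \<epsilon>\<gamma>(1,2) by algebra
  moreover have "\<epsilon> \<otimes>\<^bsub>P\<^esub> g = (\<gamma> \<otimes>\<^bsub>P\<^esub> \<epsilon>) \<otimes>\<^bsub>P\<^esub> g'"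
    unfolding \<gamma>g'[symmetric] using g'P \<epsilon>\<gamma>(1,2) by algebra
  ultimately have \<epsilon>g': "\<epsilon> \<otimes>\<^bsub>P\<^esub> g' = g'"
    using \<epsilon>\<gamma>(5) \<epsilon>F \<gamma>g' by (simp add: g'_def)
  \<comment> \<open>The multiple of \<open>g'\<close> with top coefficient \<open>e\<close>.\<close>
  define k where "k = q \<otimes>\<^bsub>P\<^esub> \<gamma> \<oplus>\<^bsub>P\<^esub> (\<one>\<^bsub>P\<^esub> \<ominus>\<^bsub>P\<^esub> \<gamma>)"
  have kP: "k \<in> carrier P"
    using q(1) \<epsilon>\<gamma>(2) by (simp add: k_def)
  have "k \<otimes>\<^bsub>P\<^esub> g' = q \<otimes>\<^bsub>P\<^esub> (\<gamma> \<otimes>\<^bsub>P\<^esub> g') \<oplus>\<^bsub>P\<^esub> (g' \<ominus>\<^bsub>P\<^esub> \<gamma> \<otimes>\<^bsub>P\<^esub> g')"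
    unfolding k_def using q(1) g'P \<epsilon>\<gamma>(2) by algebra
  also have "\<dots> = q \<otimes>\<^bsub>P\<^esub> g \<oplus>\<^bsub>P\<^esub> (g' \<ominus>\<^bsub>P\<^esub> g)"
    by (simp add: \<gamma>g')
  also have "g' \<ominus>\<^bsub>P\<^esub> g = F \<ominus>\<^bsub>P\<^esub> \<gamma> \<otimes>\<^bsub>P\<^esub> F"
    unfolding g'_def using gP F(3) \<epsilon>\<gamma>(2) by algebra
  finally have kg': "k \<otimes>\<^bsub>P\<^esub> g' = q \<otimes>\<^bsub>P\<^esub> g \<oplus>\<^bsub>P\<^esub> (F \<ominus>\<^bsub>P\<^esub> \<gamma> \<otimes>\<^bsub>P\<^esub> F)" .
  have kg'_below: "k \<otimes>\<^bsub>P\<^esub> g' \<in> below I (Suc n)"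
    unfolding kg' by (intro below_closures q F \<gamma>F)
  have "coeff P (k \<otimes>\<^bsub>P\<^esub> g') n = c \<oplus> (e \<ominus> c)"
    unfolding kg' using q F \<gamma>F gP \<epsilon>\<gamma>(2) by (simp del: coeff_mult)
  also have "\<dots> = e"
    using c(1) eR by algebra
  finally have kg'_coeff: "coeff P (k \<otimes>\<^bsub>P\<^esub> g') n = e" .
  \<comment> \<open>The invariant for \<open>n + 1\<close> asks for the coefficient one place higher, hence the factor \<open>X\<close>.\<close>
  let ?q = "monom P \<one> 1 \<otimes>\<^bsub>P\<^esub> k"
  have q_eq: "?q \<otimes>\<^bsub>P\<^esub> g' = monom P \<one> 1 \<otimes>\<^bsub>P\<^esub> (k \<otimes>\<^bsub>P\<^esub> g')"
    using kP g'P by (simp add: P.m_assoc)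
  have "?q \<otimes>\<^bsub>P\<^esub> g' \<in> below I (Suc (Suc n))" "coeff P (?q \<otimes>\<^bsub>P\<^esub> g') (Suc n) = e"
    unfolding q_eq
    using below_shift(1)[OF kg'_below R.one_closed, of 1]
      below_shift(2)[OF kg'_below R.one_closed, of 1 n] kg'_coeff eR
    by (simp_all del: coeff_mult)
  moreover have "\<exists>r\<in>carrier P. h = r \<otimes>\<^bsub>P\<^esub> g'" if h: "h \<in> below I (Suc n)" for h
  proof -
    let ?a = "monom P (coeff P h n) 0"
    have hP: "h \<in> carrier P" "?a \<in> carrier P"
      using below_closures(1)[OF h] by simp_all
    have "coeff P h n \<otimes> coeff P (k \<otimes>\<^bsub>P\<^esub> g') n = coeff P h n"
      using e(2) h kg'_coeff by (auto simp: top_coeffs_def)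
    then have "h \<ominus>\<^bsub>P\<^esub> ?a \<otimes>\<^bsub>P\<^esub> (k \<otimes>\<^bsub>P\<^esub> g') \<in> below I n"
      using cancel_top_coeff[OF h kg'_below order_refl] by simp
    then obtain r where r: "r \<in> carrier P" "h \<ominus>\<^bsub>P\<^esub> ?a \<otimes>\<^bsub>P\<^esub> (k \<otimes>\<^bsub>P\<^esub> g') = r \<otimes>\<^bsub>P\<^esub> g"
      using gen by blast
    have "h = (h \<ominus>\<^bsub>P\<^esub> ?a \<otimes>\<^bsub>P\<^esub> (k \<otimes>\<^bsub>P\<^esub> g')) \<oplus>\<^bsub>P\<^esub> ?a \<otimes>\<^bsub>P\<^esub> (k \<otimes>\<^bsub>P\<^esub> g')"
      using hP kP g'P by algebra
    also have "\<dots> = r \<otimes>\<^bsub>P\<^esub> (\<gamma> \<otimes>\<^bsub>P\<^esub> g') \<oplus>\<^bsub>P\<^esub> ?a \<otimes>\<^bsub>P\<^esub> (k \<otimes>\<^bsub>P\<^esub> g')"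
      unfolding r(2) \<gamma>g' ..
    also have "\<dots> = (r \<otimes>\<^bsub>P\<^esub> \<gamma> \<oplus>\<^bsub>P\<^esub> ?a \<otimes>\<^bsub>P\<^esub> k) \<otimes>\<^bsub>P\<^esub> g'"
      using r(1) hP kP g'P \<epsilon>\<gamma>(2) by algebra
    finally show ?thesis
      using r(1) hP kP \<epsilon>\<gamma>(2) by blast
  qed
  moreover have "?q \<in> carrier P"
    using kP by simp
  ultimately show ?case
    using g'I eR ee \<epsilon>g' unfolding \<epsilon>_def by blast
qed

text \<open>
  The top coefficients increase with the degree, and their union is an ideal, so its generator \<open>e\<close>
  already occurs at some degree \<open>N\<close>. A polynomial of degree \<open>N\<close> with top coefficient \<open>e\<close> reduces
  every element of \<open>I\<close> to degree at most \<open>N\<close>, where the preceding lemma applies.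
\<close>

lemma principal_if_idempotent_generators: "\<exists>g\<in>I. \<forall>h\<in>I. \<exists>r\<in>carrier P. h = r \<otimes>\<^bsub>P\<^esub> g"
proof -
  have "ideal (\<Union>n. top_coeffs I n) R"
  proof (rule R.idealI_add_mult)
    show "(\<Union>n. top_coeffs I n) \<subseteq> carrier R"
      using R.ideal_closures(1)[OF ideal_top_coeffs] by blast
    show "\<zero> \<in> (\<Union>n. top_coeffs I n)"
      using R.ideal_closures(2)[OF ideal_top_coeffs] by blast
  next
    fix a b assume "a \<in> (\<Union>n. top_coeffs I n)" "b \<in> (\<Union>n. top_coeffs I n)"
    then obtain m n where "a \<in> top_coeffs I m" "b \<in> top_coeffs I n"
      by blast
    then have "a \<in> top_coeffs I (max m n)" "b \<in> top_coeffs I (max m n)"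
      using top_coeffs_mono[of m "max m n"] top_coeffs_mono[of n "max m n"] by auto
    then have "a \<oplus> b \<in> top_coeffs I (max m n)"
      by (rule R.ideal_closures(3)[OF ideal_top_coeffs])
    then show "a \<oplus> b \<in> (\<Union>n. top_coeffs I n)"
      by blast
  next
    fix a x assume "a \<in> (\<Union>n. top_coeffs I n)" "x \<in> carrier R"
    then show "x \<otimes> a \<in> (\<Union>n. top_coeffs I n)"
      using R.ideal_closures(5)[OF ideal_top_coeffs] by blast
  qed
  then obtain e where e: "e \<in> (\<Union>n. top_coeffs I n)" "\<forall>x\<in>(\<Union>n. top_coeffs I n). x \<otimes> e = x"
    using idem by blast
  then obtain N f where f: "f \<in> below I (Suc N)" "coeff P f N = e"
    by (auto simp: top_coeffs_def)
  obtain g where g: "g \<in> I" "\<forall>h\<in>below I (Suc N). \<exists>r\<in>carrier P. h = r \<otimes>\<^bsub>P\<^esub> g"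
    using below_principal[of "Suc N"] by blast
  note gP = P.ideal_closures(1)[OF I g(1)]
  obtain q where q: "q \<in> carrier P" "f = q \<otimes>\<^bsub>P\<^esub> g"
    using g(2) f(1) by blast
  have "\<forall>h\<in>below I (Suc N + n). \<exists>r\<in>carrier P. h = r \<otimes>\<^bsub>P\<^esub> g" for n
  proof (induction n)
    case 0
    show ?case using g by simp
  next
    case (Suc n)
    show ?case
    proof
      fix h assume "h \<in> below I (Suc N + Suc n)"
      then have h: "h \<in> below I (Suc (Suc N + n))" by simp
      let ?a = "monom P (coeff P h (Suc N + n)) (Suc N + n - N)"
      have hP: "h \<in> carrier P" "?a \<in> carrier P"
        using below_closures(1)[OF h] by simp_all
      have "coeff P h (Suc N + n) \<in> (\<Union>n. top_coeffs I n)"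
        using h unfolding top_coeffs_def by blast
      then have "coeff P h (Suc N + n) \<otimes> coeff P f N = coeff P h (Suc N + n)"
        using e(2) f(2) by blast
      then have "h \<ominus>\<^bsub>P\<^esub> ?a \<otimes>\<^bsub>P\<^esub> f \<in> below I (Suc N + n)"
        using cancel_top_coeff[OF h f(1)] by simp
      then obtain r where r: "r \<in> carrier P" "h \<ominus>\<^bsub>P\<^esub> ?a \<otimes>\<^bsub>P\<^esub> f = r \<otimes>\<^bsub>P\<^esub> g"
        using Suc.IH by blast
      have "h = (h \<ominus>\<^bsub>P\<^esub> ?a \<otimes>\<^bsub>P\<^esub> f) \<oplus>\<^bsub>P\<^esub> ?a \<otimes>\<^bsub>P\<^esub> f"
        using hP below_closures(1)[OF f(1)] by algebra
      also have "\<dots> = r \<otimes>\<^bsub>P\<^esub> g \<oplus>\<^bsub>P\<^esub> ?a \<otimes>\<^bsub>P\<^esub> (q \<otimes>\<^bsub>P\<^esub> g)"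
        unfolding r(2) using q(2) by simp
      also have "\<dots> = (r \<oplus>\<^bsub>P\<^esub> ?a \<otimes>\<^bsub>P\<^esub> q) \<otimes>\<^bsub>P\<^esub> g"
        using r(1) hP(2) q(1) gP by algebra
      finally show "\<exists>r\<in>carrier P. h = r \<otimes>\<^bsub>P\<^esub> g"
        using r(1) hP(2) q(1) by blast
    qed
  qed
  moreover have "\<exists>n. h \<in> below I (Suc N + n)" if "h \<in> I" for h
  proof -
    have "h \<in> carrier P"
      using P.ideal_closures(1)[OF I that] .
    then have "\<forall>i\<ge>Suc N + deg R h. coeff P h i = \<zero>"
      by (auto intro: deg_aboveD)
    then show ?thesis
      using that by (auto simp: below_def)
  qed
  ultimately show ?thesis
    using g(1) by blast
qed

end

end

lemma principal_ideal_ring_polynomials: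
  assumes "von_neumann_regular_ring R \<and> principal_ideal_ring R"
  shows "principal_ideal_ring P"
  unfolding P.principal_ideal_ring_iff
  using principal_if_idempotent_generators R.vnr_pir_iff_idempotent_generators[THEN iffD1, OF assms] by simp

section \<open>The Anderson ring\<close>

text \<open>
  The two primes that give \<open>R[X]\<close> dimension one contain no polynomial with constant term \<open>1\<close>, so
  they survive in the Anderson ring and stay distinct.
\<close>

lemma anderson_ring_one_dimensional_pir:
  assumes "\<one> \<noteq> \<zero>" and pir: "principal_ideal_ring P"
  shows "principal_ideal_ring (anderson_ring R)" "krull_dim (anderson_ring R) = 1"
proof -
  let ?A = "constant_term_one R"
  let ?E = "\<lambda>Q. {fraction P ?A b t | b t. b \<in> Q \<and> t \<in> ?A}"
  have A: "submonoid ?A P"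
    using R.submonoid_constant_term_one by (simp add: P_def)
  have L: "anderson_ring R = localization P ?A"
    by (simp add: anderson_ring_def P_def)
  interpret L: cring "localization P ?A"
    by (rule P.cring_localization[OF A])
  show pirL: "principal_ideal_ring (anderson_ring R)"
    unfolding L by (rule P.principal_ideal_ring_localization[OF A pir])
  obtain M where M: "primeideal M R"
    using R.exists_primeideal assms by blast
  let ?Q0 = "{f \<in> carrier P. \<forall>i. coeff P f i \<in> M}"
  let ?Q1 = "{f \<in> carrier P. coeff P f 0 \<in> M}"
  have disj1: "?Q1 \<inter> ?A = {}"
    using primeideal.one_not_mem[OF M] by (auto simp: constant_term_one_def P_def)
  then have disj0: "?Q0 \<inter> ?A = {}"
    by auto
  note Q0 = primeideal_all_coeffs[OF M] and Q1 = primeideal_constant_coeff[OF M]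
  obtain f where f: "f \<in> ?Q1" "f \<notin> ?Q0"
    using coeff_ideals_less[OF M] by blast
  have "fraction P ?A f \<one>\<^bsub>P\<^esub> \<in> ?E ?Q1 - ?E ?Q0"
    using P.fraction_mem_extension_iff[OF A Q1 disj1, of f "\<one>\<^bsub>P\<^esub>"]
      P.fraction_mem_extension_iff[OF A Q0 disj0, of f "\<one>\<^bsub>P\<^esub>"] f P.S_mem(2)[OF A] by simp
  then have "?E ?Q0 \<subset> ?E ?Q1"
    by blast
  then show "krull_dim (anderson_ring R) = 1"
    unfolding L
    by (rule L.krull_dim_principal_ideal_ring[OF pirL[unfolded L]
        P.primeideal_localization[OF A Q0 disj0] P.primeideal_localization[OF A Q1 disj1]])
qed

text \<open>
  Let \<open>J\<close> be an ideal of \<open>R\<close>. The fractions \<open>f/s\<close> with \<open>f(0)\<close> in \<open>J\<close> form an ideal, generated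
  by some \<open>f/s\<close>. Membership of the constant \<open>x\<close> from \<open>J\<close> shows that \<open>c = f(0)\<close> generates \<open>J\<close>. The
  ideal also contains \<open>X\<close>, which gives an equation \<open>vX = qf\<close> with \<open>v(0) = 1\<close>. Its coefficients
  of degree \<open>0\<close> and \<open>1\<close> say that \<open>q\<^sub>0c = 0\<close> and \<open>q\<^sub>0f\<^sub>1 + q\<^sub>1c = 1\<close>. Multiplying the
  second by \<open>c\<close> leaves \<open>c = q\<^sub>1c\<^sup>2\<close>, so \<open>q\<^sub>1c\<close> is an idempotent generator of \<open>J\<close>.
\<close>

lemma regular_if_anderson_ring_principal:
  assumes pir: "principal_ideal_ring (anderson_ring R)"
  shows "von_neumann_regular_ring R \<and> principal_ideal_ring R"
  unfolding R.vnr_pir_iff_idempotent_generators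
proof (intro allI impI)
  fix J assume J: "ideal J R"
  note cl = R.ideal_closures[OF J]
  let ?A = "constant_term_one R" and ?L = "anderson_ring R"
  have A: "submonoid ?A P"
    using R.submonoid_constant_term_one by (simp add: P_def)
  have L_def: "?L = localization P ?A"
    by (simp add: anderson_ring_def P_def)
  interpret L: cring ?L
    by (rule R.cring_anderson_ring)
  note A_cl = P.S_mem[OF A]
  note ops = P.localization_mult[OF A, folded L_def] P.localization_add[OF A, folded L_def]
    P.localization_one_zero[OF A, folded L_def]
  have A0: "coeff P s 0 = \<one>" if "s \<in> ?A" for s
    using that by (simp add: constant_term_one_def P_def)
  let ?E = "{fraction P ?A f s | f s. f \<in> carrier P \<and> coeff P f 0 \<in> J \<and> s \<in> ?A}"
  have "ideal ?E ?L"
  proof (rule L.idealI_add_mult)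
    show "?E \<subseteq> carrier ?L"
      unfolding L_def P.localization_carrier[OF A] by blast
    show "\<zero>\<^bsub>?L\<^esub> \<in> ?E"
      using cl(2) A_cl(2) unfolding ops by force
  next
    fix x y assume "x \<in> ?E" "y \<in> ?E"
    then obtain f s g t where x: "f \<in> carrier P" "coeff P f 0 \<in> J" "s \<in> ?A" "x = fraction P ?A f s"
      and y: "g \<in> carrier P" "coeff P g 0 \<in> J" "t \<in> ?A" "y = fraction P ?A g t"
      by blast
    have "coeff P (f \<otimes>\<^bsub>P\<^esub> t \<oplus>\<^bsub>P\<^esub> g \<otimes>\<^bsub>P\<^esub> s) 0 \<in> J"
      using x y A_cl(1) by (simp add: cl A0 coeff_mult_0 del: coeff_mult)
    moreover have "x \<oplus>\<^bsub>?L\<^esub> y = fraction P ?A (f \<otimes>\<^bsub>P\<^esub> t \<oplus>\<^bsub>P\<^esub> g \<otimes>\<^bsub>P\<^esub> s) (s \<otimes>\<^bsub>P\<^esub> t)"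
      using x y by (simp add: ops)
    moreover have "f \<otimes>\<^bsub>P\<^esub> t \<oplus>\<^bsub>P\<^esub> g \<otimes>\<^bsub>P\<^esub> s \<in> carrier P"
      using x y A_cl(1) by simp
    ultimately show "x \<oplus>\<^bsub>?L\<^esub> y \<in> ?E"
      using A_cl(3)[OF x(3) y(3)] by blast
  next
    fix x y assume "x \<in> ?E" and y: "y \<in> carrier ?L"
    then obtain f s where x: "f \<in> carrier P" "coeff P f 0 \<in> J" "s \<in> ?A" "x = fraction P ?A f s"
      by blast
    obtain g t where g: "g \<in> carrier P" "t \<in> ?A" "y = fraction P ?A g t"
      using y A unfolding L_def by (rule P.fraction_cases)
    have "coeff P (g \<otimes>\<^bsub>P\<^esub> f) 0 \<in> J"
      using x g by (simp add: cl coeff_mult_0 del: coeff_mult)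
    moreover have "y \<otimes>\<^bsub>?L\<^esub> x = fraction P ?A (g \<otimes>\<^bsub>P\<^esub> f) (t \<otimes>\<^bsub>P\<^esub> s)"
      using x g by (simp add: ops)
    moreover have "g \<otimes>\<^bsub>P\<^esub> f \<in> carrier P"
      using x g by simp
    ultimately show "y \<otimes>\<^bsub>?L\<^esub> x \<in> ?E"
      using A_cl(3)[OF g(2) x(3)] by blast
  qed
  then have "\<exists>w\<in>?E. \<forall>h\<in>?E. \<exists>q\<in>carrier ?L. h = q \<otimes>\<^bsub>?L\<^esub> w"
    by (rule L.principal_ideal_ring_iff[THEN iffD1, OF pir, THEN spec, THEN mp])
  then obtain w where w: "w \<in> ?E" "\<forall>h\<in>?E. \<exists>q\<in>carrier ?L. h = q \<otimes>\<^bsub>?L\<^esub> w" ..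
  then obtain f s where f: "f \<in> carrier P" "coeff P f 0 \<in> J" "s \<in> ?A" "w = fraction P ?A f s"
    by blast
  \<comment> \<open>The generating property after clearing denominators. The factor \<open>v\<close> is harmless because its
    constant coefficient is \<open>1\<close>.\<close>
  have multiple: "\<exists>v\<in>?A. \<exists>q\<in>carrier P. v \<otimes>\<^bsub>P\<^esub> h = q \<otimes>\<^bsub>P\<^esub> f"
    if h: "h \<in> carrier P" "coeff P h 0 \<in> J" for h
  proof -
    have "fraction P ?A h \<one>\<^bsub>P\<^esub> \<in> ?E"
      using h A_cl(2) by blast
    then obtain y where y: "y \<in> carrier ?L" "fraction P ?A h \<one>\<^bsub>P\<^esub> = y \<otimes>\<^bsub>?L\<^esub> w"
      using w(2) by blast
    obtain q t where q: "q \<in> carrier P" "t \<in> ?A" "y = fraction P ?A q t"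
      using y(1) A unfolding L_def by (rule P.fraction_cases)
    have "fraction P ?A h \<one>\<^bsub>P\<^esub> = fraction P ?A (q \<otimes>\<^bsub>P\<^esub> f) (t \<otimes>\<^bsub>P\<^esub> s)"
      using y(2) q f by (simp add: ops)
    then obtain u where u: "u \<in> ?A"
      "u \<otimes>\<^bsub>P\<^esub> (h \<otimes>\<^bsub>P\<^esub> (t \<otimes>\<^bsub>P\<^esub> s)) = u \<otimes>\<^bsub>P\<^esub> (q \<otimes>\<^bsub>P\<^esub> f \<otimes>\<^bsub>P\<^esub> \<one>\<^bsub>P\<^esub>)"
      using q f h A_cl(2) A_cl(3)[OF q(2) f(3)] by (subst (asm) P.fraction_eq_iff[OF A]) auto
    have "u \<otimes>\<^bsub>P\<^esub> t \<otimes>\<^bsub>P\<^esub> s \<otimes>\<^bsub>P\<^esub> h = u \<otimes>\<^bsub>P\<^esub> q \<otimes>\<^bsub>P\<^esub> f"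
      using u q f h A_cl(1) by (simp add: P.m_ac)
    moreover have "u \<otimes>\<^bsub>P\<^esub> t \<otimes>\<^bsub>P\<^esub> s \<in> ?A"
      by (intro A_cl(3) u q f)
    moreover have "u \<otimes>\<^bsub>P\<^esub> q \<in> carrier P"
      using u q A_cl(1) by simp
    ultimately show ?thesis
      by blast
  qed
  define c where "c = coeff P f 0"
  have c: "c \<in> carrier R" "c \<in> J"
    using f by (simp_all add: c_def)
  obtain v q where v: "v \<in> ?A" "q \<in> carrier P" "v \<otimes>\<^bsub>P\<^esub> monom P \<one> 1 = q \<otimes>\<^bsub>P\<^esub> f"
    using multiple[of "monom P \<one> 1"] cl(2) by auto
  have vc: "v \<in> carrier P"
    by (rule A_cl(1)[OF v(1)])
  have e0: "coeff P q 0 \<otimes> c = \<zero>"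
    using arg_cong[OF v(3), of "\<lambda>p. coeff P p 0"] v(2) vc f(1)
    by (simp add: coeff_mult_0 c_def del: coeff_mult)
  have e1: "coeff P q 0 \<otimes> coeff P f 1 \<oplus> coeff P q 1 \<otimes> c = \<one>"
    using arg_cong[OF v(3), of "\<lambda>p. coeff P p 1"] v(2) vc f(1) A0[OF v(1)]
    by (simp add: coeff_mult_1 c_def del: coeff_mult One_nat_def)
  define a b d where "a = coeff P q 0" and "b = coeff P f 1" and "d = coeff P q 1"
  have abd: "a \<in> carrier R" "b \<in> carrier R" "d \<in> carrier R"
    using f v by (simp_all add: a_def b_def d_def)
  have "c = c \<otimes> (a \<otimes> b \<oplus> d \<otimes> c)"
    using e1 c by (simp add: a_def b_def d_def)
  also have "\<dots> = (a \<otimes> c) \<otimes> b \<oplus> c \<otimes> (d \<otimes> c)"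
    using c abd by algebra
  also have "\<dots> = c \<otimes> (d \<otimes> c)"
    using e0 c abd by (simp add: a_def)
  finally have cdc: "c \<otimes> (d \<otimes> c) = c" by simp
  show "\<exists>e\<in>J. \<forall>x\<in>J. x \<otimes> e = x"
  proof (rule bexI[of _ "d \<otimes> c"], rule ballI)
    fix x assume x: "x \<in> J"
    obtain v q where v: "v \<in> ?A" "q \<in> carrier P" "v \<otimes>\<^bsub>P\<^esub> monom P x 0 = q \<otimes>\<^bsub>P\<^esub> f"
      using multiple[of "monom P x 0"] x cl(1)[OF x] by auto
    have "x = coeff P q 0 \<otimes> c"
      using arg_cong[OF v(3), of "\<lambda>p. coeff P p 0"] v(2) A_cl(1)[OF v(1)] f(1) A0[OF v(1)] cl(1)[OF x]
      by (simp add: coeff_mult_0 c_def del: coeff_mult)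
    then show "x \<otimes> (d \<otimes> c) = x"
      using cdc c abd v(2) by (simp add: R.m_assoc)
  qed (use cl c abd in auto)
qed

end

theorem theorem3p1:
  fixes R (structure)
  assumes "cring R" and "\<one> \<noteq> \<zero>"
  shows "((von_neumann_regular_ring R \<and> principal_ideal_ring R) \<longleftrightarrow>
            (principal_ideal_ring (UP R) \<and> krull_dim (UP R) = 1)) \<and>
         ((principal_ideal_ring (UP R) \<and> krull_dim (UP R) = 1) \<longleftrightarrow>
            (principal_ideal_ring (anderson_ring R) \<and> krull_dim (anderson_ring R) = 1))"
proof -
  interpret cring R by fact
  interpret UP_cring R "UP R"
    by unfold_locales
  let ?one = "von_neumann_regular_ring R \<and> principal_ideal_ring R"
  let ?two = "principal_ideal_ring (UP R) \<and> krull_dim (UP R) = 1"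
  let ?three = "principal_ideal_ring (anderson_ring R) \<and> krull_dim (anderson_ring R) = 1"
  have "?two" if "?one"
    using principal_ideal_ring_polynomials[OF that] krull_dim_polynomials[OF assms(2)] by simp
  moreover have "?three" if "?two"
    using anderson_ring_one_dimensional_pir[OF assms(2)] that by simp
  moreover have "?one" if "?three"
    using regular_if_anderson_ring_principal that by simp
  ultimately show ?thesis
    by argo
qed

end
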